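(* In the setting of the inexact two-level method without postsmoothing described in the context, suppose that $$\big\|A_{\rm c}^{-1}\mathbf{r}_{k-1}-\mathscr{B}_{\rm c}^{(k)}(\mathbf{r}_{k-1})\big\|_{A_{\rm c}}\leq\varepsilon_{k}\|\mathbf{r}_{k-1}\|_{A_{\rm c}^{-1}}$$ for some $\varepsilon_{k}\in[0,1)$ and all $k=1,2,\ldots,\nu$, and set $\varepsilon=\prod_{k=1}^{\nu}\varepsilon_{k}$. Then the output $\mathbf{u}^{(2)}$ of the inexact two-level method without postsmoothing satisfies $$\big\|\mathbf{u}-\mathbf{u}^{(2)}\big\|_{A}\leq\bigg(1-\frac{1-\varepsilon^{2}}{K_{\rm TL}}\bigg)^{\frac{1}{2}}\big\|\mathbf{u}-\mathbf{u}^{(0)}\big\|_{A}.$$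
   Context: Setting. $A\in\mathbb{R}^{n\times n}$ is symmetric positive definite (SPD), $\mathbf{f}\in\mathbb{R}^{n}$, and $\mathbf{u}=A^{-1}\mathbf{f}$. $S\in\mathbb{R}^{n\times n_{\rm s}}$ and $P\in\mathbb{R}^{n\times n_{\rm c}}$ have full column rank, the block matrix $(S\ \ P)$ has rank $n$, and $\max\{n_{\rm s},n_{\rm c}\}<n\leq n_{\rm s}+n_{\rm c}$. Put $A_{\rm s}=S^{T}AS$ and $A_{\rm c}=P^{T}AP$. $M_{\rm s}\in\mathbb{R}^{n_{\rm s}\times n_{\rm s}}$ is nonsingular (not necessarily symmetric) and $M_{\rm s}+M_{\rm s}^{T}-A_{\rm s}$ is SPD. $\nu\geq1$ is an integer, and for $k=1,\ldots,\nu$, $\mathscr{B}_{\rm c}^{(k)}:\mathbb{R}^{n_{\rm c}}\to\mathbb{R}^{n_{\rm c}}$ is a general (possibly nonlinear) mapping. Inexact two-level method without postsmoothing. Given an initial guess $\mathbf{u}^{(0)}\in\mathbb{R}^{n}$: (1) $\mathbf{u}^{(1)}=\mathbf{u}^{(0)}+SM_{\rm s}^{-1}S^{T}(\mathbf{f}-A\mathbf{u}^{(0)})$; (2) $\mathbf{r}_{\rm c}=P^{T}(\mathbf{f}-A\mathbf{u}^{(1)})$; (3) $\mathbf{e}_{\rm c}^{(0)}=\mathbf{0}$ and $\mathbf{e}_{\rm c}^{(k)}=\mathbf{e}_{\rm c}^{(k-1)}+\mathscr{B}_{\rm c}^{(k)}(\mathbf{r}_{\rm c}-A_{\rm c}\mathbf{e}_{\rm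 c}^{(k-1)})$ for $k=1,\ldots,\nu$; (4) $\mathbf{u}^{(2)}=\mathbf{u}^{(1)}+P\mathbf{e}_{\rm c}^{(\nu)}$, which is the output. Coarse residuals. Let $\Phi_{\rm c}^{(k)}(\mathbf{x})=\mathbf{x}-A_{\rm c}\mathscr{B}_{\rm c}^{(k)}(\mathbf{x})$. Define $\mathbf{r}_{0}=\mathbf{r}_{\rm c}$ and $\mathbf{r}_{k}=(\Phi_{\rm c}^{(k)}\circ\cdots\circ\Phi_{\rm c}^{(1)})(\mathbf{r}_{\rm c})$ for $k=1,\ldots,\nu$. Norms. For an SPD matrix $G$, $\|\mathbf{v}\|_{G}=\sqrt{\mathbf{v}^{T}G\mathbf{v}}$. Quantities. $\varPi_{A}=PA_{\rm c}^{-1}P^{T}A$, $\widetilde{M}_{\rm s}=M_{\rm s}^{T}(M_{\rm s}+M_{\rm s}^{T}-A_{\rm s})^{-1}M_{\rm s}$, and $$K_{\rm TL}=\sup_{\mathbf{v}\in\operatorname{range}(I-\varPi_{A})\setminus\{\mathbf{0}\}}\ \inf_{\mathbf{v}_{\rm s}\in\mathbb{R}^{n_{\rm s}}:\ \mathbf{v}=(I-\varPi_{A})S\mathbf{v}_{\rm s}}\frac{\mathbf{v}_{\rm s}^{T}\widetilde{M}_{\rm s}\mathbf{v}_{\rm s}}{\mathbf{v}^{T}A\mathbf{v}}.$$ *)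

theory Defs
  imports "HOL-Analysis.Analysis"
begin

definition spd :: "real^'n^'n \<Rightarrow> bool" where
  "spd G \<longleftrightarrow> transpose G = G \<and> (\<forall>v. v \<noteq> 0 \<longrightarrow> v \<bullet> (G *v v) > 0)"

definition energy_norm :: "real^'n^'n \<Rightarrow> real^'n \<Rightarrow> real" where
  "energy_norm G v = sqrt (v \<bullet> (G *v v))"

text \<open>The block matrix \<open>(S P)\<close>; its columns are indexed by the disjoint sum of the two column
  index types.\<close>

definition block_row :: "real^'s^'n \<Rightarrow> real^'c^'n \<Rightarrow> real^('s + 'c)^'n" where
  "block_row S P = (\<chi> i j. case j of Inl a \<Rightarrow> S $ i $ a | Inr b \<Rightarrow> P $ i $ b)"

text \<open>The Galerkin product \<open>Q\<^sup>T A Q\<close>: it gives \<open>A\<^sub>s\<close> for \<open>Q = S\<close> and \<open>A\<^sub>c\<close> for \<open>Q = P\<close>.\<close>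

definition galerkin :: "real^'n^'n \<Rightarrow> real^'m^'n \<Rightarrow> real^'m^'m" where
  "galerkin A Q = transpose Q ** A ** Q"

definition smoothed :: "real^'n^'n \<Rightarrow> real^'s^'n \<Rightarrow> real^'s^'s \<Rightarrow> real^'n \<Rightarrow> real^'n \<Rightarrow> real^'n" where
  "smoothed A S M f u0 = u0 + S *v (matrix_inv M *v (transpose S *v (f - A *v u0)))"

definition coarse_residual ::
    "real^'n^'n \<Rightarrow> real^'s^'n \<Rightarrow> real^'c^'n \<Rightarrow> real^'s^'s \<Rightarrow> real^'n \<Rightarrow> real^'n \<Rightarrow> real^'c" where
  "coarse_residual A S P M f u0 = transpose P *v (f - A *v smoothed A S M f u0)"

text \<open>The coarse solvers are a family \<open>B k\<close> of arbitrary maps; only the indices \<open>k \<ge> 1\<close> are used.\<close>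

primrec coarse_iterate ::
    "real^'c^'c \<Rightarrow> (nat \<Rightarrow> real^'c \<Rightarrow> real^'c) \<Rightarrow> real^'c \<Rightarrow> nat \<Rightarrow> real^'c" where
  "coarse_iterate Ac B r 0 = 0"
| "coarse_iterate Ac B r (Suc k) =
     coarse_iterate Ac B r k + B (Suc k) (r - Ac *v coarse_iterate Ac B r k)"

definition two_level_output ::
    "real^'n^'n \<Rightarrow> real^'s^'n \<Rightarrow> real^'c^'n \<Rightarrow> real^'s^'s \<Rightarrow> (nat \<Rightarrow> real^'c \<Rightarrow> real^'c)
      \<Rightarrow> nat \<Rightarrow> real^'n \<Rightarrow> real^'n \<Rightarrow> real^'n" where
  "two_level_output A S P M B \<nu> f u0 =
     smoothed A S M f u0 + P *v coarse_iterate (galerkin A P) B (coarse_residual A S P M f u0) \<nu>"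

definition \<Phi>c :: "real^'c^'c \<Rightarrow> (nat \<Rightarrow> real^'c \<Rightarrow> real^'c) \<Rightarrow> nat \<Rightarrow> real^'c \<Rightarrow> real^'c" where
  "\<Phi>c Ac B k x = x - Ac *v B k x"

primrec \<Phi>c_comp :: "real^'c^'c \<Rightarrow> (nat \<Rightarrow> real^'c \<Rightarrow> real^'c) \<Rightarrow> nat \<Rightarrow> real^'c \<Rightarrow> real^'c" where
  "\<Phi>c_comp Ac B 0 = id"
| "\<Phi>c_comp Ac B (Suc k) = \<Phi>c Ac B (Suc k) \<circ> \<Phi>c_comp Ac B k"

definition residual ::
    "real^'n^'n \<Rightarrow> real^'s^'n \<Rightarrow> real^'c^'n \<Rightarrow> real^'s^'s \<Rightarrow> (nat \<Rightarrow> real^'c \<Rightarrow> real^'c)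
      \<Rightarrow> real^'n \<Rightarrow> real^'n \<Rightarrow> nat \<Rightarrow> real^'c" where
  "residual A S P M B f u0 k = \<Phi>c_comp (galerkin A P) B k (coarse_residual A S P M f u0)"

definition Pi_A :: "real^'n^'n \<Rightarrow> real^'c^'n \<Rightarrow> real^'n^'n" where
  "Pi_A A P = P ** matrix_inv (galerkin A P) ** transpose P ** A"

definition M_tilde :: "real^'n^'n \<Rightarrow> real^'s^'n \<Rightarrow> real^'s^'s \<Rightarrow> real^'s^'s" where
  "M_tilde A S M = transpose M ** matrix_inv (M + transpose M - galerkin A S) ** M"

text \<open>The supremum and infimum are taken in the reals. This is harmless when \<open>A\<close> and
  \<open>M + M\<^sup>T - A\<^sub>s\<close> are SPD, the block matrix \<open>(S P)\<close> has rank \<open>n\<close> and \<open>n\<^sub>c < n\<close>. The outer index set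
  is then nonempty because \<open>n\<^sub>c < n\<close>. The rank condition makes the range of \<open>(I - \<Pi>\<^sub>A) S\<close> all of
  the range of \<open>I - \<Pi>\<^sub>A\<close>, so every inner set is nonempty; its quotients are nonnegative. A linear
  choice of the preimage \<open>v\<^sub>s\<close> bounds the infima uniformly in \<open>v\<close>.\<close>

definition K_TL :: "real^'n^'n \<Rightarrow> real^'s^'n \<Rightarrow> real^'c^'n \<Rightarrow> real^'s^'s \<Rightarrow> real" where
  "K_TL A S P M =
     (SUP v \<in> range (\<lambda>w. (mat 1 - Pi_A A P) *v w) - {0}.
        INF vs \<in> {vs. v = (mat 1 - Pi_A A P) *v (S *v vs)}.
          (vs \<bullet> (M_tilde A S M *v vs)) / (v \<bullet> (A *v v)))"

end

theory Submission
  imports Defs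
begin

text \<open>
  Write \<open>e = u - u0\<close>, \<open>N = M + M\<^sup>T - A\<^sub>s\<close>, let \<open>Q = I - \<Pi>\<^sub>A\<close> be the \<open>A\<close>-orthogonal projection that
  removes the coarse component, and let \<open>T = I - S M\<^sup>-\<^sup>1 S\<^sup>T A\<close> be the error propagation of the smoother.
  The error after smoothing is \<open>e1 = T e\<close>. An exact coarse solve would leave \<open>Q e1\<close>; the inexact one
  leaves \<open>Q e1 + P d\<close>, where \<open>d\<close> is the error of the coarse iterate. The two parts are
  \<open>A\<close>-orthogonal. The \<open>A\<^sub>c\<close>-norm of the coarse error equals the dual norm of its residual, so the
  accuracy assumption shrinks it by \<open>\<epsilon>\<^sub>k\<close> in step \<open>k\<close> (\<open>coarse_error_bound\<close>), from the initial value
  \<open>\<parallel>\<Pi>\<^sub>A e1\<parallel>\<^sub>A\<close>. Hence the squared final error is at most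
  \<open>\<parallel>Q e1\<parallel>\<^sup>2 + \<epsilon>\<^sup>2 \<parallel>\<Pi>\<^sub>A e1\<parallel>\<^sup>2 = (1 - \<epsilon>\<^sup>2) \<parallel>Q e1\<parallel>\<^sup>2 + \<epsilon>\<^sup>2 \<parallel>e1\<parallel>\<^sup>2\<close>,
  and the claim is this convex combination of the two bounds \<open>\<parallel>Q T e\<parallel>\<^sup>2 \<le> (1 - 1/K) \<parallel>e\<parallel>\<^sup>2\<close>
  (\<open>smoothed_complement_bound\<close>) and \<open>\<parallel>T e\<parallel>\<^sup>2 \<le> \<parallel>e\<parallel>\<^sup>2\<close> (from \<open>smoothing_energy\<close>), with \<open>K\<close> the
  two-level constant.

  The first of these bounds passes to the \<open>A\<close>-adjoint \<open>T\<^sup>* = I - S M\<^sup>-\<^sup>T S\<^sup>T A\<close>, since \<open>Q T\<close> and its adjoint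
  \<open>T\<^sup>* Q\<close> have the same norm. For \<open>v\<close> in the range of \<open>Q\<close> and \<open>z = M\<^sup>-\<^sup>T S\<^sup>T A v\<close> one has
  \<open>\<parallel>T\<^sup>* v\<parallel>\<^sup>2 = \<parallel>v\<parallel>\<^sup>2 - z\<^sup>T N z\<close>, so it remains to see that \<open>z\<^sup>T N z \<ge> \<parallel>v\<parallel>\<^sup>2 / K\<close> (\<open>K_TL_lower_bound\<close>).
  Whenever \<open>v = Q S v\<^sub>s\<close>, orthogonality gives \<open>\<parallel>v\<parallel>\<^sup>2 = v\<^sup>T A S v\<^sub>s = z\<^sup>T M v\<^sub>s\<close>, and the Cauchy-Schwarz
  inequality in the dual pair of norms of \<open>N\<close> and \<open>N\<^sup>-\<^sup>1\<close> bounds the square of the latter by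
  \<open>(z\<^sup>T N z) (v\<^sub>s\<^sup>T M\<^sup>T N\<^sup>-\<^sup>1 M v\<^sub>s)\<close>. The last factor is the quadratic form whose quotients define \<open>K\<close>.
\<close>

section \<open>Symmetric positive definite matrices\<close>

(* Products with a transpose must stay in column form for the adjoint identity below to apply. *)
declare transpose_matrix_vector [simp del] vector_transpose_matrix [simp del]

lemma inner_matrix_vector_mult:
  fixes G :: "real^'m^'n"
  shows "x \<bullet> (G *v y) = (transpose G *v x) \<bullet> y"
  by (simp add: dot_lmul_matrix transpose_matrix_vector)

lemma spd_inner_commute: "spd G \<Longrightarrow> x \<bullet> (G *v y) = y \<bullet> (G *v x)"
  by (metis inner_commute inner_matrix_vector_mult spd_def)

lemma spd_inner_nonneg: "spd G \<Longrightarrow> 0 \<le> x \<bullet> (G *v x)"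
  by (cases "x = 0") (auto simp: spd_def intro: less_imp_le)

lemma spd_inner_pos: "spd G \<Longrightarrow> x \<noteq> 0 \<Longrightarrow> 0 < x \<bullet> (G *v x)"
  by (simp add: spd_def)

lemma energy_norm_nonneg: "spd G \<Longrightarrow> 0 \<le> energy_norm G x"
  by (simp add: energy_norm_def spd_inner_nonneg)

lemma energy_norm_sq: "spd G \<Longrightarrow> (energy_norm G x)\<^sup>2 = x \<bullet> (G *v x)"
  by (simp add: energy_norm_def spd_inner_nonneg)

lemma energy_Cauchy_Schwarz:
  assumes "spd G"
  shows "(x \<bullet> (G *v y))\<^sup>2 \<le> (x \<bullet> (G *v x)) * (y \<bullet> (G *v y))"
proof (cases "y = 0")
  case False
  define a b c where "a = x \<bullet> (G *v x)" and "b = y \<bullet> (G *v y)" and "c = x \<bullet> (G *v y)"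
  have b: "b > 0"
    using spd_inner_pos[OF assms False] by (simp add: b_def)
  have c: "y \<bullet> (G *v x) = c"
    using spd_inner_commute[OF assms] by (simp add: c_def)
  (* b x - c y is b times the component of x that is G-orthogonal to y. *)
  have "0 \<le> (b *\<^sub>R x - c *\<^sub>R y) \<bullet> (G *v (b *\<^sub>R x - c *\<^sub>R y))"
    by (rule spd_inner_nonneg[OF assms])
  also have "\<dots> = b * (a * b - c\<^sup>2)"
    by (simp add: matrix_vector_mult_diff_distrib matrix_vector_mult_scaleR inner_diff_left
        inner_diff_right c a_def[symmetric] b_def[symmetric] c_def[symmetric] algebra_simps
        power2_eq_square)
  finally have "0 \<le> a * b - c\<^sup>2"
    using b by (simp add: zero_le_mult_iff)
  then show ?thesis
    by (simp add: a_def b_def c_def)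
qed simp

lemma matrix_inv_mult_right: "invertible G \<Longrightarrow> G *v (matrix_inv G *v x) = x"
  and matrix_inv_mult_left: "invertible G \<Longrightarrow> matrix_inv G *v (G *v x) = x"
  for G :: "real^'n^'n"
proof -
  assume "invertible G"
  then have "G ** matrix_inv G = mat 1 \<and> matrix_inv G ** G = mat 1"
    unfolding invertible_def matrix_inv_def by (rule someI_ex)
  then show "G *v (matrix_inv G *v x) = x" "matrix_inv G *v (G *v x) = x"
    by (simp_all add: matrix_vector_mul_assoc)
qed

lemma spd_imp_invertible:
  assumes "spd G"
  shows "invertible G"
proof -
  have "\<forall>x. G *v x = 0 \<longrightarrow> x = 0"
    using spd_inner_pos[OF assms] by force
  then show ?thesis
    by (simp add: invertible_left_inverse matrix_left_invertible_ker)
qed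

lemmas spd_inv_mult = spd_imp_invertible[THEN matrix_inv_mult_right]
  spd_imp_invertible[THEN matrix_inv_mult_left]

text \<open>The form of \<open>H\<close> is bounded by a multiple of the squared Euclidean norm, and that norm
  is bounded by a multiple of the energy of \<open>A\<close>: with \<open>x = A\<^sup>-\<^sup>1 v\<close>, the Cauchy-Schwarz inequality in the energy gives
  \<open>\<parallel>v\<parallel>\<^sup>4 = (v\<^sup>T A x)\<^sup>2 \<le> (v\<^sup>T A v) (v\<^sup>T A\<^sup>-\<^sup>1 v) \<le> (v\<^sup>T A v) \<parallel>A\<^sup>-\<^sup>1\<parallel> \<parallel>v\<parallel>\<^sup>2\<close>. It serves to show that the
  supremum in the two-level constant is finite.\<close>

lemma energy_dominates_quadratic_form:
  fixes A H :: "real^'n^'n"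
  assumes A: "spd A"
  shows "\<exists>C. \<forall>v. v \<bullet> (H *v v) \<le> C * (v \<bullet> (A *v v))"
proof -
  define a h where "a = onorm ((*v) (matrix_inv A))" and "h = onorm ((*v) H)"
  have bound: "x \<bullet> (G *v x) \<le> onorm ((*v) G) * (norm x)\<^sup>2" for G :: "real^'n^'n" and x
  proof -
    have "x \<bullet> (G *v x) \<le> norm x * norm (G *v x)"
      by (rule norm_cauchy_schwarz)
    also have "\<dots> \<le> norm x * (onorm ((*v) G) * norm x)"
      by (intro mult_left_mono onorm) auto
    finally show ?thesis
      by (simp add: power2_eq_square ac_simps)
  qed
  have "h \<ge> 0"
    by (simp add: h_def onorm_pos_le)
  have coercive: "(norm v)\<^sup>2 \<le> a * (v \<bullet> (A *v v))" for v
  proof (cases "v = 0")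
    case False
    define x where "x = matrix_inv A *v v"
    have Ax: "A *v x = v"
      by (simp add: x_def spd_inv_mult A)
    have "((norm v)\<^sup>2)\<^sup>2 = (v \<bullet> (A *v x))\<^sup>2"
      by (simp add: Ax power2_norm_eq_inner)
    also have "\<dots> \<le> (v \<bullet> (A *v v)) * (x \<bullet> v)"
      using energy_Cauchy_Schwarz[OF A, of v x] by (simp add: Ax)
    also have "\<dots> \<le> (v \<bullet> (A *v v)) * (a * (norm v)\<^sup>2)"
      using bound[of v "matrix_inv A"] spd_inner_nonneg[OF A, of v]
      by (intro mult_left_mono) (simp_all add: a_def x_def inner_commute)
    finally have "(norm v)\<^sup>2 * (norm v)\<^sup>2 \<le> (a * (v \<bullet> (A *v v))) * (norm v)\<^sup>2"
      by (simp add: power2_eq_square ac_simps)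
    then show ?thesis
      using False by (simp only: mult_le_cancel_right) simp
  qed simp
  have "v \<bullet> (H *v v) \<le> (h * a) * (v \<bullet> (A *v v))" for v
    using bound[of v H] mult_left_mono[OF coercive[of v] \<open>h \<ge> 0\<close>] by (simp add: h_def ac_simps)
  then show ?thesis
    by blast
qed

section \<open>The Galerkin product and the coarse projection\<close>

lemma galerkin_mult: "galerkin A Q *v y = transpose Q *v (A *v (Q *v y))"
  by (simp add: galerkin_def matrix_vector_mul_assoc matrix_mul_assoc)

lemma inner_galerkin: "x \<bullet> (galerkin A Q *v y) = (Q *v x) \<bullet> (A *v (Q *v y))"
  by (simp add: galerkin_mult inner_matrix_vector_mult)

lemma spd_galerkin:
  assumes A: "spd A" and inj: "inj ((*v) P)"
  shows "spd (galerkin A P)"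
  unfolding spd_def
proof (intro conjI allI impI)
  show "transpose (galerkin A P) = galerkin A P"
    using A by (simp add: galerkin_def matrix_transpose_mul spd_def matrix_mul_assoc)
next
  fix v :: "real^'b"
  assume "v \<noteq> 0"
  then have "P *v v \<noteq> 0"
    using injD[OF inj, of v 0] by auto
  then show "0 < v \<bullet> (galerkin A P *v v)"
    by (simp add: inner_galerkin spd_inner_pos A)
qed

lemma coarse_complement_eq:
  "(mat 1 - Pi_A A P) *v x
     = x - P *v (matrix_inv (galerkin A P) *v (transpose P *v (A *v x)))"
  by (simp add: Pi_A_def matrix_vector_mult_diff_rdistrib matrix_vector_mul_assoc matrix_mul_assoc)

text \<open>The range of \<open>I - \<Pi>\<^sub>A\<close> is \<open>A\<close>-orthogonal to the coarse space, because \<open>P\<^sup>T A P A\<^sub>c\<^sup>-\<^sup>1\<close> is the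
  identity. This makes \<open>I - \<Pi>\<^sub>A\<close> an \<open>A\<close>-orthogonal projection, so idempotence, self-adjointness and the
  Pythagorean identity below are consequences.\<close>

lemma coarse_complement_orthogonal:
  assumes "spd A" and "inj ((*v) P)"
  shows "transpose P *v (A *v ((mat 1 - Pi_A A P) *v x)) = 0"
  by (simp add: coarse_complement_eq matrix_vector_mult_diff_distrib
      spd_inv_mult spd_galerkin assms flip: galerkin_mult)

lemma coarse_complement_of_coarse:
  assumes "spd A" and "inj ((*v) P)"
  shows "(mat 1 - Pi_A A P) *v (P *v y) = 0"
  by (simp add: coarse_complement_eq spd_inv_mult spd_galerkin assms flip: galerkin_mult)

lemma coarse_complement_idem:
  assumes "spd A" and "inj ((*v) P)"
  shows "(mat 1 - Pi_A A P) *v ((mat 1 - Pi_A A P) *v x) = (mat 1 - Pi_A A P) *v x"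
  by (subst (1) coarse_complement_eq) (simp add: coarse_complement_orthogonal assms)

lemma coarse_complement_self_adjoint:
  assumes A: "spd A" and P: "inj ((*v) P)" and v: "(mat 1 - Pi_A A P) *v v = v"
  shows "v \<bullet> (A *v ((mat 1 - Pi_A A P) *v x)) = v \<bullet> (A *v x)"
proof -
  have "transpose P *v (A *v v) = 0"
    using coarse_complement_orthogonal[OF A P, of v] by (simp add: v)
  then have "v \<bullet> (A *v (P *v y)) = 0" for y
    by (metis spd_inner_commute[OF A] inner_commute inner_matrix_vector_mult inner_zero_left)
  then show ?thesis
    by (simp add: coarse_complement_eq matrix_vector_mult_diff_distrib inner_diff_right)
qed

lemma coarse_Pythagoras:
  assumes A: "spd A" and P: "inj ((*v) P)"
  shows "((mat 1 - Pi_A A P) *v x + P *v z) \<bullet> (A *v ((mat 1 - Pi_A A P) *v x + P *v z))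
    = ((mat 1 - Pi_A A P) *v x) \<bullet> (A *v ((mat 1 - Pi_A A P) *v x)) + z \<bullet> (galerkin A P *v z)"
proof -
  define q where "q = (mat 1 - Pi_A A P) *v x"
  have "(P *v z) \<bullet> (A *v q) = 0"
    using coarse_complement_orthogonal[OF A P, of x]
    by (metis q_def inner_commute inner_matrix_vector_mult inner_zero_left)
  moreover have "q \<bullet> (A *v (P *v z)) = (P *v z) \<bullet> (A *v q)"
    by (rule spd_inner_commute[OF A])
  ultimately show ?thesis
    unfolding q_def[symmetric]
    by (simp add: inner_galerkin matrix_vector_right_distrib inner_add_left inner_add_right)
qed

section \<open>Smoothing\<close>

text \<open>The smoothing step with \<open>w = M\<^sup>-\<^sup>1 S\<^sup>T A e\<close>: the cross term \<open>w\<^sup>T M w\<close> of the square enters twice,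
  which gives \<open>w\<^sup>T (M + M\<^sup>T) w\<close>, and the quadratic term is \<open>w\<^sup>T A\<^sub>s w\<close>. As the
  smoother is given by an equation for \<open>w\<close>, the lemma applies to \<open>M\<close> and to \<open>M\<^sup>T\<close>, that is, to \<open>T\<close> and
  to its adjoint, with the same energy loss matrix.\<close>

lemma smoothing_energy:
  assumes A: "spd A" and w: "transpose S *v (A *v e) = M *v w"
  shows "(e - S *v w) \<bullet> (A *v (e - S *v w))
    = e \<bullet> (A *v e) - w \<bullet> ((M + transpose M - galerkin A S) *v w)"
proof -
  have 1: "(S *v w) \<bullet> (A *v e) = w \<bullet> (M *v w)"
    using w by (metis inner_commute inner_matrix_vector_mult)
  have 2: "e \<bullet> (A *v (S *v w)) = w \<bullet> (M *v w)"
    using 1 spd_inner_commute[OF A] by simp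
  have 3: "w \<bullet> (transpose M *v w) = w \<bullet> (M *v w)"
    by (metis inner_commute inner_matrix_vector_mult)
  show ?thesis
    by (simp add: matrix_vector_mult_diff_distrib matrix_vector_mult_diff_rdistrib
        matrix_vector_mult_add_rdistrib inner_diff_left inner_diff_right inner_add_right
        1 2 3 inner_galerkin)
qed

text \<open>Both sides differ from \<open>v\<^sup>T A e\<close> by the same number \<open>z\<^sup>T M w\<close>. Thus the smoother with \<open>M\<^sup>T\<close> is the
  adjoint of the smoother with \<open>M\<close> in the energy inner product.\<close>

lemma smoothing_adjoint:
  assumes A: "spd A"
    and w: "transpose S *v (A *v e) = M *v w"
    and z: "transpose S *v (A *v v) = transpose M *v z"
  shows "v \<bullet> (A *v (e - S *v w)) = (v - S *v z) \<bullet> (A *v e)"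
proof -
  have "v \<bullet> (A *v (S *v w)) = (S *v w) \<bullet> (A *v v)"
    by (rule spd_inner_commute[OF A])
  also have "\<dots> = (transpose M *v z) \<bullet> w"
    by (metis z inner_commute inner_matrix_vector_mult)
  also have "\<dots> = z \<bullet> (transpose S *v (A *v e))"
    by (simp add: w inner_matrix_vector_mult)
  also have "\<dots> = (S *v z) \<bullet> (A *v e)"
    by (simp add: inner_matrix_vector_mult transpose_transpose)
  finally show ?thesis
    by (simp add: matrix_vector_mult_diff_distrib inner_diff_left inner_diff_right)
qed

section \<open>The two-level constant\<close>

lemma inner_M_tilde:
  "x \<bullet> (M_tilde A S M *v x)
     = (M *v x) \<bullet> (matrix_inv (M + transpose M - galerkin A S) *v (M *v x))"
proof -
  have "M_tilde A S M *v x
      = transpose M *v (matrix_inv (M + transpose M - galerkin A S) *v (M *v x))"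
    by (simp add: M_tilde_def matrix_vector_mul_assoc matrix_mul_assoc)
  then show ?thesis
    by (simp add: inner_matrix_vector_mult)
qed

lemma block_row_mult:
  "block_row S P *v x = S *v (\<chi> i. x $ Inl i) + P *v (\<chi> j. x $ Inr j)"
proof -
  have "(block_row S P *v x) $ i = (S *v (\<chi> i. x $ Inl i) + P *v (\<chi> j. x $ Inr j)) $ i" for i
    by (simp add: matrix_vector_mult_def block_row_def UNIV_Plus_UNIV[symmetric] sum.Plus
        del: UNIV_Plus_UNIV)
  then show ?thesis
    by (simp add: vec_eq_iff)
qed

text \<open>A right inverse of \<open>(S P)\<close> splits any \<open>v\<close> as \<open>S R v\<close> plus a coarse vector, and \<open>I - \<Pi>\<^sub>A\<close>
  removes the latter. The preimage under \<open>(I - \<Pi>\<^sub>A) S\<close> is thus linear in \<open>v\<close>, which makes the quotients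
  in the two-level constant bounded uniformly in \<open>v\<close>.\<close>

lemma ex_smoother_preimage:
  fixes S :: "real^'s^'n" and P :: "real^'c^'n"
  assumes A: "spd A" and P: "inj ((*v) P)" and SP: "rank (block_row S P) = CARD('n)"
  shows "\<exists>R :: real^'n^'s. \<forall>v. (mat 1 - Pi_A A P) *v (S *v (R *v v)) = (mat 1 - Pi_A A P) *v v"
proof -
  obtain W where W: "block_row S P ** W = mat 1"
    using SP full_rank_surjective matrix_right_invertible_surjective by blast
  define R :: "real^'n^'s" where "R = (\<chi> i. W $ Inl i)"
  have "(mat 1 - Pi_A A P) *v (S *v (R *v v)) = (mat 1 - Pi_A A P) *v v" for v
  proof -
    have "v = block_row S P *v (W *v v)"
      by (simp add: matrix_vector_mul_assoc W)
    also have "\<dots> = S *v (\<chi> i. (W *v v) $ Inl i) + P *v (\<chi> j. (W *v v) $ Inr j)"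
      by (rule block_row_mult)
    also have "(\<chi> i. (W *v v) $ Inl i) = R *v v"
      by (simp add: R_def matrix_vector_mult_def)
    finally have "v = S *v (R *v v) + P *v (\<chi> j. (W *v v) $ Inr j)" .
    then show ?thesis
      by (metis matrix_vector_right_distrib coarse_complement_of_coarse[OF A P] add.right_neutral)
  qed
  then show ?thesis
    by blast
qed

text \<open>Each quotient at \<open>v = (I - \<Pi>\<^sub>A) S v\<^sub>s\<close> is at least \<open>v\<^sup>T A v / z\<^sup>T N z\<close>, by the Cauchy-Schwarz inequality for
  \<open>v\<^sup>T A v = z\<^sup>T N x\<close> with \<open>x = N\<^sup>-\<^sup>1 M v\<^sub>s\<close>. So the infimum at \<open>v\<close> is at least that large, and the supremum
  dominates the infimum once it is known to be taken over a bounded set.\<close>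

lemma K_TL_lower_bound:
  fixes S :: "real^'s^'n" and P :: "real^'c^'n"
  assumes A: "spd A" and P: "inj ((*v) P)" and SP: "rank (block_row S P) = CARD('n)"
    and N: "spd (M + transpose M - galerkin A S)"
    and v: "(mat 1 - Pi_A A P) *v v = v" "v \<noteq> 0"
    and z: "transpose S *v (A *v v) = transpose M *v z"
  shows "v \<bullet> (A *v v) \<le> K_TL A S P M * (z \<bullet> ((M + transpose M - galerkin A S) *v z))"
proof -
  define N where "N = M + transpose M - galerkin A S"
  define Q where "Q = mat 1 - Pi_A A P"
  define q where "q v vs = (vs \<bullet> (M_tilde A S M *v vs)) / (v \<bullet> (A *v v))" for v vs
  have spdN: "spd N"
    using N by (simp add: N_def)
  have K: "K_TL A S P M = (SUP v \<in> range (\<lambda>w. Q *v w) - {0}. INF vs \<in> {vs. v = Q *v (S *v vs)}. q v vs)"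
    by (simp add: K_TL_def Q_def q_def)
  obtain R :: "real^'n^'s" where R: "Q *v (S *v (R *v v)) = Q *v v" for v
    using ex_smoother_preimage[OF A P SP] by (auto simp: Q_def)
  have Q_fix: "Q *v v = v" if "v \<in> range (\<lambda>w. Q *v w)" for v
    using that coarse_complement_idem[OF A P] by (auto simp: Q_def)
  have M_tilde: "vs \<bullet> (M_tilde A S M *v vs)
      = (matrix_inv N *v (M *v vs)) \<bullet> (N *v (matrix_inv N *v (M *v vs)))" for vs
    by (simp add: inner_M_tilde N_def[symmetric] spd_inv_mult spdN inner_commute)
  have q_nonneg: "0 \<le> q v vs" for v vs
    by (simp add: q_def M_tilde spd_inner_nonneg spdN A)
  have q_bdd: "bdd_below (q v ` X)" for v X
    using q_nonneg by (rule bdd_belowI2)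
  obtain C where C: "v \<bullet> (galerkin (M_tilde A S M) R *v v) \<le> C * (v \<bullet> (A *v v))" for v
    using energy_dominates_quadratic_form[OF A] by blast
  have "(INF vs \<in> {vs. v = Q *v (S *v vs)}. q v vs) \<le> C"
    if "v \<in> range (\<lambda>w. Q *v w) - {0}" for v
  proof -
    have "(INF vs \<in> {vs. v = Q *v (S *v vs)}. q v vs) \<le> q v (R *v v)"
      using R[of v] Q_fix[of v] that by (intro cINF_lower q_bdd) auto
    also have "\<dots> \<le> C"
      using C[of v] spd_inner_pos[OF A, of v] that
      by (simp add: q_def divide_le_eq inner_galerkin)
    finally show ?thesis .
  qed
  then have bdd: "bdd_above ((\<lambda>v. INF vs \<in> {vs. v = Q *v (S *v vs)}. q v vs) ` (range (\<lambda>w. Q *v w) - {0}))"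
    by (rule bdd_aboveI2)
  define a b where "a = v \<bullet> (A *v v)" and "b = z \<bullet> (N *v z)"
  have a: "a > 0"
    using spd_inner_pos[OF A v(2)] by (simp add: a_def)
  have Qv: "Q *v v = v"
    using v(1) by (simp add: Q_def)
  have key: "a\<^sup>2 \<le> b * (vs \<bullet> (M_tilde A S M *v vs))" if vs: "v = Q *v (S *v vs)" for vs
  proof -
    define x where "x = matrix_inv N *v (M *v vs)"
    have "a = v \<bullet> (A *v (S *v vs))"
      using coarse_complement_self_adjoint[OF A P v(1), of "S *v vs"] vs by (simp add: a_def Q_def)
    also have "\<dots> = (S *v vs) \<bullet> (A *v v)"
      by (rule spd_inner_commute[OF A])
    also have "\<dots> = (transpose M *v z) \<bullet> vs"
      by (metis z inner_commute inner_matrix_vector_mult)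
    also have "\<dots> = z \<bullet> (N *v x)"
      by (simp add: x_def spd_inv_mult spdN inner_matrix_vector_mult)
    finally show ?thesis
      using energy_Cauchy_Schwarz[OF spdN, of z x] by (simp add: M_tilde b_def x_def)
  qed
  have pre: "v = Q *v (S *v (R *v v))"
    using R Qv by simp
  have b: "b > 0"
  proof -
    have "0 < b * ((R *v v) \<bullet> (M_tilde A S M *v (R *v v)))"
      using key[OF pre] a by (smt (verit) zero_less_power)
    moreover have "b \<ge> 0"
      by (simp add: b_def spd_inner_nonneg spdN)
    ultimately show ?thesis
      by (metis less_eq_real_def mult_zero_left less_irrefl)
  qed
  have "a / b \<le> q v vs" if "v = Q *v (S *v vs)" for vs
    using key[OF that] a b
    by (simp add: q_def a_def[symmetric] divide_simps power2_eq_square mult.commute)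
  then have "a / b \<le> (INF vs \<in> {vs. v = Q *v (S *v vs)}. q v vs)"
    using pre by (intro cINF_greatest) auto
  also have "\<dots> \<le> K_TL A S P M"
    unfolding K using v(2) Qv by (intro cSUP_upper bdd) (auto intro: range_eqI[where x = v])
  finally show ?thesis
    using b by (simp add: a_def b_def N_def divide_le_eq)
qed

text \<open>A vector outside the coarse space has a nonzero image under the projection. It witnesses that
  \<open>1 - 1/K\<close> is nonnegative in the next lemma.\<close>

lemma ex_fixed_coarse_complement:
  fixes P :: "real^'c^'n"
  assumes A: "spd A" and P: "inj ((*v) P)" and "CARD('c) < CARD('n)"
  shows "\<exists>v. v \<noteq> 0 \<and> (mat 1 - Pi_A A P) *v v = v"
proof -
  have "rank P \<noteq> CARD('n)"
    using rank_bound[of P] assms(3) by simp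
  then obtain x where x: "x \<notin> range ((*v) P)"
    using full_rank_surjective[of P] by blast
  then have "(mat 1 - Pi_A A P) *v x \<noteq> 0"
    by (auto simp: coarse_complement_eq)
  then show ?thesis
    using coarse_complement_idem[OF A P] by blast
qed

text \<open>Duality: with \<open>T\<close> the error propagation of the smoother and \<open>g = (I - \<Pi>\<^sub>A) T e\<close>,
  \<open>\<parallel>g\<parallel>\<^sup>2 = \<langle>g, T e\<rangle> = \<langle>T\<^sup>* g, e\<rangle> \<le> \<parallel>T\<^sup>* g\<parallel> \<parallel>e\<parallel>\<close> in the energy inner product, and on the range of the projection
  \<open>T\<^sup>*\<close> contracts the squared energy by \<open>1 - 1/K\<close>. The case \<open>g = 0\<close> needs this factor to be
  nonnegative, which follows from the contraction itself at any nonzero vector of that range.\<close>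

lemma smoothed_complement_bound:
  fixes S :: "real^'s^'n" and P :: "real^'c^'n"
  assumes A: "spd A" and P: "inj ((*v) P)" and c: "CARD('c) < CARD('n)"
    and SP: "rank (block_row S P) = CARD('n)"
    and M: "invertible M" and N: "spd (M + transpose M - galerkin A S)"
    and w: "transpose S *v (A *v e) = M *v w"
  defines "g \<equiv> (mat 1 - Pi_A A P) *v (e - S *v w)"
  shows "g \<bullet> (A *v g) \<le> (1 - 1 / K_TL A S P M) * (e \<bullet> (A *v e))"
proof -
  define K where "K = K_TL A S P M"
  have adj: "\<exists>z. transpose S *v (A *v v) = transpose M *v z
      \<and> (v - S *v z) \<bullet> (A *v (v - S *v z)) \<le> (1 - 1 / K) * (v \<bullet> (A *v v))"
    if v: "(mat 1 - Pi_A A P) *v v = v" "v \<noteq> 0" for v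
  proof -
    define z where "z = matrix_inv (transpose M) *v (transpose S *v (A *v v))"
    define b where "b = z \<bullet> ((M + transpose M - galerkin A S) *v z)"
    have z: "transpose S *v (A *v v) = transpose M *v z"
      by (simp add: z_def matrix_inv_mult_right transpose_invertible M)
    have "v \<bullet> (A *v v) \<le> K * b"
      using K_TL_lower_bound[OF A P SP N v z] by (simp add: K_def b_def)
    moreover have "0 < v \<bullet> (A *v v)" "0 \<le> b"
      using spd_inner_pos[OF A v(2)] spd_inner_nonneg[OF N] by (auto simp: b_def)
    ultimately have "(v \<bullet> (A *v v)) / K \<le> b"
      by (smt (verit) divide_le_eq mult.commute mult_nonneg_nonpos2 mult_nonneg_nonpos)
    moreover have "(v - S *v z) \<bullet> (A *v (v - S *v z)) = v \<bullet> (A *v v) - b"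
      using smoothing_energy[OF A z] by (simp add: b_def transpose_transpose add.commute)
    ultimately show ?thesis
      using z by (auto simp: algebra_simps)
  qed
  have K1: "0 \<le> 1 - 1 / K"
  proof -
    obtain v where v: "v \<noteq> 0" "(mat 1 - Pi_A A P) *v v = v"
      using ex_fixed_coarse_complement[OF A P c] by blast
    then obtain z where "(v - S *v z) \<bullet> (A *v (v - S *v z)) \<le> (1 - 1 / K) * (v \<bullet> (A *v v))"
      using adj by blast
    then have "0 \<le> (1 - 1 / K) * (v \<bullet> (A *v v))"
      using spd_inner_nonneg[OF A] by (meson order_trans)
    then show ?thesis
      using spd_inner_pos[OF A v(1)] by (simp add: zero_le_mult_iff)
  qed
  show ?thesis
  proof (cases "g = 0")
    case True
    then show ?thesis
      using K1 spd_inner_nonneg[OF A, of e] by (simp add: K_def)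
  next
    case False
    have Qg: "(mat 1 - Pi_A A P) *v g = g"
      by (simp add: g_def coarse_complement_idem A P)
    obtain z where z: "transpose S *v (A *v g) = transpose M *v z"
      and le: "(g - S *v z) \<bullet> (A *v (g - S *v z)) \<le> (1 - 1 / K) * (g \<bullet> (A *v g))"
      using adj[OF Qg False] by blast
    have "g \<bullet> (A *v g) = (g - S *v z) \<bullet> (A *v e)"
      using coarse_complement_self_adjoint[OF A P Qg, of "e - S *v w"] smoothing_adjoint[OF A w z]
      by (simp add: g_def)
    then have "(g \<bullet> (A *v g))\<^sup>2 \<le> ((g - S *v z) \<bullet> (A *v (g - S *v z))) * (e \<bullet> (A *v e))"
      using energy_Cauchy_Schwarz[OF A] by simp
    also have "\<dots> \<le> ((1 - 1 / K) * (g \<bullet> (A *v g))) * (e \<bullet> (A *v e))"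
      by (intro mult_right_mono le spd_inner_nonneg[OF A])
    finally have "(g \<bullet> (A *v g)) * (g \<bullet> (A *v g))
        \<le> ((1 - 1 / K) * (e \<bullet> (A *v e))) * (g \<bullet> (A *v g))"
      by (simp add: power2_eq_square ac_simps)
    then show ?thesis
      using spd_inner_pos[OF A False] by (simp add: K_def)
  qed
qed

section \<open>The inexact coarse solve\<close>

lemma \<Phi>c_comp_eq_residual: "\<Phi>c_comp Ac B k r = r - Ac *v coarse_iterate Ac B r k"
  by (induction k) (simp_all add: \<Phi>c_def matrix_vector_right_distrib)

text \<open>The dual norm of a residual \<open>G x\<close> is the energy norm of the error \<open>x\<close> that it belongs to.\<close>

lemma energy_norm_matrix_inv:
  assumes "spd G"
  shows "energy_norm (matrix_inv G) (G *v x) = energy_norm G x"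
  using assms by (simp add: energy_norm_def spd_inv_mult inner_commute)

text \<open>If \<open>d\<close> is the coarse error after \<open>k - 1\<close> steps, then the current residual is \<open>A\<^sub>c d\<close> and the next error is
  \<open>d - B k (A\<^sub>c d)\<close>. The accuracy assumption bounds exactly the norm of this vector by \<open>\<epsilon>\<^sub>k\<close> times the norm
  of \<open>d\<close>. The initial error is \<open>A\<^sub>c\<^sup>-\<^sup>1 r\<close> since the iteration starts at zero.\<close>

lemma coarse_error_bound:
  fixes Ac :: "real^'c^'c"
  assumes Ac: "spd Ac"
    and eps: "\<And>k. k \<in> {1..m} \<Longrightarrow> 0 \<le> \<epsilon>k k"
    and acc: "\<And>k. k \<in> {1..m} \<Longrightarrow>
      energy_norm Ac (matrix_inv Ac *v \<Phi>c_comp Ac B (k - 1) r - B k (\<Phi>c_comp Ac B (k - 1) r))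
        \<le> \<epsilon>k k * energy_norm (matrix_inv Ac) (\<Phi>c_comp Ac B (k - 1) r)"
  shows "energy_norm Ac (matrix_inv Ac *v r - coarse_iterate Ac B r m)
    \<le> (\<Prod>k=1..m. \<epsilon>k k) * energy_norm Ac (matrix_inv Ac *v r)"
  using eps acc
proof (induction m)
  case (Suc m)
  define d where "d = matrix_inv Ac *v r - coarse_iterate Ac B r m"
  have res: "\<Phi>c_comp Ac B m r = Ac *v d"
    by (simp add: \<Phi>c_comp_eq_residual d_def matrix_vector_mult_diff_distrib spd_inv_mult Ac)
  have "matrix_inv Ac *v r - coarse_iterate Ac B r (Suc m) = d - B (Suc m) (Ac *v d)"
    by (simp add: d_def matrix_vector_mult_diff_distrib spd_inv_mult Ac)
  then have "energy_norm Ac (matrix_inv Ac *v r - coarse_iterate Ac B r (Suc m))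
      \<le> \<epsilon>k (Suc m) * energy_norm Ac d"
    using Suc.prems(2)[of "Suc m"] by (simp add: res spd_inv_mult Ac energy_norm_matrix_inv)
  also have "\<dots> \<le> \<epsilon>k (Suc m) * ((\<Prod>k=1..m. \<epsilon>k k) * energy_norm Ac (matrix_inv Ac *v r))"
    unfolding d_def using Suc.prems by (intro mult_left_mono Suc.IH) auto
  finally show ?case
    by (simp add: prod.nat_ivl_Suc' ac_simps)
qed simp

section \<open>Convergence of the two-level method\<close>

theorem theorem3p7:
  fixes A :: "real^'n^'n" and S :: "real^'s^'n" and P :: "real^'c^'n" and M :: "real^'s^'s"
    and B :: "nat \<Rightarrow> real^'c \<Rightarrow> real^'c" and \<nu> :: nat
    and f u u0 :: "real^'n" and \<epsilon>k :: "nat \<Rightarrow> real" and \<epsilon> :: real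
  assumes A_spd: "spd A"
    and u_def: "u = matrix_inv A *v f"
    and rank_S: "rank S = CARD('s)"
    and rank_P: "rank P = CARD('c)"
    and rank_SP: "rank (block_row S P) = CARD('n)"
    and dims: "max CARD('s) CARD('c) < CARD('n)" "CARD('n) \<le> CARD('s) + CARD('c)"
    and M_inv: "invertible M"
    and M_spd: "spd (M + transpose M - galerkin A S)"
    and \<nu>: "\<nu> \<ge> 1"
    and \<epsilon>k_range: "\<And>k. k \<in> {1..\<nu>} \<Longrightarrow> \<epsilon>k k \<in> {0..<1}"
    and coarse_accuracy: "\<And>k. k \<in> {1..\<nu>} \<Longrightarrow>
       energy_norm (galerkin A P)
         (matrix_inv (galerkin A P) *v residual A S P M B f u0 (k - 1)
            - B k (residual A S P M B f u0 (k - 1)))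
       \<le> \<epsilon>k k * energy_norm (matrix_inv (galerkin A P)) (residual A S P M B f u0 (k - 1))"
    and \<epsilon>_def: "\<epsilon> = (\<Prod>k=1..\<nu>. \<epsilon>k k)"
  shows "energy_norm A (u - two_level_output A S P M B \<nu> f u0)
    \<le> sqrt (1 - (1 - \<epsilon>\<^sup>2) / K_TL A S P M) * energy_norm A (u - u0)"
proof -
  define Ac K where "Ac = galerkin A P" and "K = K_TL A S P M"
  define e w where "e = u - u0" and "w = matrix_inv M *v (transpose S *v (A *v e))"
  define e1 where "e1 = e - S *v w"
  define g where "g = (mat 1 - Pi_A A P) *v e1"
  define r y where "r = transpose P *v (A *v e1)" and "y = matrix_inv Ac *v r"
  define d where "d = y - coarse_iterate Ac B r \<nu>"
  have P: "inj ((*v) P)"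
    using rank_P full_rank_injective by blast
  have Ac: "spd Ac"
    by (simp add: Ac_def spd_galerkin A_spd P)
  have f: "f = A *v u"
    by (simp add: u_def spd_inv_mult A_spd)
  have w: "transpose S *v (A *v e) = M *v w"
    by (simp add: w_def matrix_inv_mult_right M_inv)
  have e1: "u - smoothed A S M f u0 = e1"
    by (simp add: smoothed_def e1_def w_def e_def f matrix_vector_mult_diff_distrib)
  have r: "coarse_residual A S P M f u0 = r"
    by (simp add: coarse_residual_def r_def f flip: matrix_vector_mult_diff_distrib e1)
  have e1_split: "e1 = g + P *v y"
    by (simp add: g_def coarse_complement_eq y_def r_def Ac_def)
  have out: "u - two_level_output A S P M B \<nu> f u0 = g + P *v d"
  proof -
    have "u - two_level_output A S P M B \<nu> f u0
        = (u - smoothed A S M f u0) - P *v coarse_iterate Ac B r \<nu>"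
      by (simp add: two_level_output_def r Ac_def)
    also have "\<dots> = g + P *v d"
      unfolding e1 by (subst e1_split) (simp add: d_def matrix_vector_mult_diff_distrib)
    finally show ?thesis .
  qed
  have eps0: "0 \<le> \<epsilon>"
    unfolding \<epsilon>_def using \<epsilon>k_range by (intro prod_nonneg) auto
  have eps1: "\<epsilon> \<le> 1"
    unfolding \<epsilon>_def using \<epsilon>k_range by (intro prod_le_1) (auto simp: less_imp_le)
  have "energy_norm Ac d \<le> \<epsilon> * energy_norm Ac y"
    unfolding d_def y_def \<epsilon>_def
    using \<epsilon>k_range coarse_accuracy
    by (intro coarse_error_bound[OF Ac]) (auto simp: residual_def r Ac_def)
  then have "(energy_norm Ac d)\<^sup>2 \<le> (\<epsilon> * energy_norm Ac y)\<^sup>2"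
    by (intro power_mono energy_norm_nonneg Ac)
  then have d: "d \<bullet> (Ac *v d) \<le> \<epsilon>\<^sup>2 * (y \<bullet> (Ac *v y))"
    by (simp add: power_mult_distrib energy_norm_sq Ac)
  have pyth: "(g + P *v x) \<bullet> (A *v (g + P *v x)) = g \<bullet> (A *v g) + x \<bullet> (Ac *v x)" for x
    unfolding g_def Ac_def by (rule coarse_Pythagoras[OF A_spd P])
  have e1_le: "e1 \<bullet> (A *v e1) \<le> e \<bullet> (A *v e)"
    using smoothing_energy[OF A_spd w] spd_inner_nonneg[OF M_spd, of w] by (simp add: e1_def)
  have g_le: "g \<bullet> (A *v g) \<le> (1 - 1 / K) * (e \<bullet> (A *v e))"
    unfolding g_def e1_def K_def
    using dims(1) by (intro smoothed_complement_bound A_spd P rank_SP M_inv M_spd w) simp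
  have "(g + P *v d) \<bullet> (A *v (g + P *v d)) \<le> g \<bullet> (A *v g) + \<epsilon>\<^sup>2 * (y \<bullet> (Ac *v y))"
    using d by (simp add: pyth)
  also have "\<dots> = (1 - \<epsilon>\<^sup>2) * (g \<bullet> (A *v g)) + \<epsilon>\<^sup>2 * (e1 \<bullet> (A *v e1))"
    using pyth[of y] by (simp add: e1_split[symmetric] algebra_simps)
  also have "\<dots> \<le> (1 - \<epsilon>\<^sup>2) * ((1 - 1 / K) * (e \<bullet> (A *v e))) + \<epsilon>\<^sup>2 * (e \<bullet> (A *v e))"
    using eps0 eps1 by (intro add_mono mult_left_mono g_le e1_le) (auto simp: power_le_one)
  also have "\<dots> = (1 - (1 - \<epsilon>\<^sup>2) / K) * (e \<bullet> (A *v e))"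
    by (simp add: algebra_simps diff_divide_distrib)
  finally have "sqrt ((g + P *v d) \<bullet> (A *v (g + P *v d)))
      \<le> sqrt ((1 - (1 - \<epsilon>\<^sup>2) / K) * (e \<bullet> (A *v e)))"
    by (rule real_sqrt_le_mono)
  then show ?thesis
    by (simp add: energy_norm_def out real_sqrt_mult K_def e_def)
qed

end
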